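(* We have $$\sum_{n=0}^\infty\big(q^{n(n+1)}+q^{5n(n+1)+1}\big)=\frac{(q^3,q^7,q^{10};q^{10})_\infty\,(q^4,q^{16};q^{20})_\infty}{(q,q^4;q^5)_\infty}.$$
   Context: Here $q$ is a complex number with $|q|<1$ (equivalently, the identity may be read as an identity of formal power series in $q$). For a complex number $a$, $(a;q)_\infty:=\prod_{i=0}^\infty(1-aq^i)$, and $(a_1,a_2,\dots,a_m;q)_\infty:=\prod_{j=1}^m(a_j;q)_\infty$. *)

theory Defs
  imports "HOL-Analysis.Analysis"
begin

definition qpoch_inf :: "complex \<Rightarrow> complex \<Rightarrow> complex" where
  "qpoch_inf a q = (\<Prod>i. 1 - a * q ^ i)"

definition qpochs_inf :: "complex list \<Rightarrow> complex \<Rightarrow> complex" where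
  "qpochs_inf as q = (\<Prod>a\<leftarrow>as. qpoch_inf a q)"

lemma has_prod_qpoch_inf:
  assumes "norm q < 1"
  shows "(\<lambda>i. 1 - a * q ^ i) has_prod qpoch_inf a q"
proof -
  have "summable (\<lambda>i. norm (1 - a * q ^ i - 1))"
    using assms by (simp add: norm_mult norm_power summable_mult summable_geometric)
  then have "convergent_prod (\<lambda>i. 1 - a * q ^ i)"
    by (intro abs_convergent_prod_imp_convergent_prod summable_imp_abs_convergent_prod)
  then show ?thesis
    unfolding qpoch_inf_def by (rule convergent_prod_has_prod)
qed

end

theory Submission
  imports Defs
begin

text \<open>
  Write \<open>q = p\<^sup>2\<close> and \<open>\<theta>(p, z) = \<Sum> z\<^sup>n p\<^bsup>n\<^sup>2\<^esup>\<close>, the sum running over all integers \<open>n\<close>. Put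
  \<open>A = \<theta>(q\<^sup>5, q\<^sup>3)\<close>, \<open>B = \<theta>(q\<^sup>5, q)\<close>, \<open>u = \<theta>(p\<^sup>5, -p\<^sup>3)\<close>, \<open>v = \<theta>(p\<^sup>5, -p)\<close>.
  The series is \<open>(G + qH) / 2\<close> with \<open>G = \<theta>(q, q)\<close> and \<open>H = \<theta>(q\<^sup>5, q\<^sup>5)\<close>, and the Jacobi triple
  product turns the product side into \<open>X = A v / u\<close>. Let \<open>Y = B u / v\<close>. Splitting the double series of
  \<open>u\<^sup>2\<close>, \<open>v\<^sup>2\<close> and \<open>u v\<close> by the parity of the index sum gives \<open>X - Y = qH\<close>; splitting that of \<open>G\<^sup>2\<close>
  over the cosets of the ideal \<open>(2 + i)\<close> in the Gaussian integers gives \<open>G\<^sup>2 = q\<^sup>2 H\<^sup>2 + 4 X Y\<close>. Hence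
  \<open>(2X - qH)\<^sup>2 = G\<^sup>2\<close>. As \<open>G\<close> has no zero in the unit disc, the sign in \<open>2X - qH = \<plusminus>G\<close> is constant
  there by continuity, and it is \<open>+\<close> at \<open>q = 0\<close>.
\<close>

subsection \<open>Infinite sums\<close>

text \<open>Dominated convergence for unordered sums: the majorant \<open>M\<close> makes the finite
  partial sums converge uniformly in \<open>n\<close> by the Weierstrass test, so the limit in
  \<open>n\<close> and the summation may be exchanged.\<close>

lemma tendsto_infsum_dominated:
  fixes f :: "nat \<Rightarrow> 'a \<Rightarrow> 'b :: banach"
  assumes S: "\<And>n. (f n has_sum S n) A"
    and lim: "\<And>k. k \<in> A \<Longrightarrow> (\<lambda>n. f n k) \<longlonglongrightarrow> g k"
    and bound: "\<And>n k. k \<in> A \<Longrightarrow> norm (f n k) \<le> M k"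
    and M: "M summable_on A"
  shows "S \<longlonglongrightarrow> infsum g A"
proof -
  have g_bound: "norm (g k) \<le> M k" if "k \<in> A" for k
    by (rule tendsto_upperbound[OF tendsto_norm[OF lim[OF that]]]) (use bound[OF that] in auto)
  have "g summable_on A"
    using Infinite_Sum.abs_summable_on_comparison_test'[OF M g_bound] Infinite_Sum.abs_summable_summable by blast
  then have g_sum: "((\<lambda>X. \<Sum>k\<in>X. g k) \<longlongrightarrow> infsum g A) (finite_subsets_at_top A)"
    using has_sum_infsum has_sum_def by metis
  have "uniform_limit UNIV (\<lambda>X n. \<Sum>k\<in>X. f n k) S (finite_subsets_at_top A)"
    by (rule Weierstrass_m_test_general'[where M = M]) (use bound S M in auto)
  then show ?thesis
  proof (rule swap_uniform_limit'[rotated 2])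
    show "\<forall>\<^sub>F X in finite_subsets_at_top A. ((\<lambda>n. \<Sum>k\<in>X. f n k) \<longlongrightarrow> (\<Sum>k\<in>X. g k)) sequentially"
      by (rule eventually_finite_subsets_at_top_weakI) (use lim in \<open>auto intro!: tendsto_sum\<close>)
  qed (use g_sum in auto)
qed

text \<open>Absolute summability of both factors passes to the product family, which can then be
  summed row by row.\<close>

lemma has_sum_times:
  fixes f :: "'a \<Rightarrow> complex" and g :: "'b \<Rightarrow> complex"
  assumes "(\<lambda>x. norm (f x)) summable_on A" "(\<lambda>y. norm (g y)) summable_on B" "(f has_sum a) A" "(g has_sum b) B"
  shows "((\<lambda>(x, y). f x * g y) has_sum (a * b)) (A \<times> B)"
proof (rule has_sum_SigmaI[where g = "\<lambda>x. f x * b"])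
  show "((\<lambda>x. f x * b) has_sum a * b) A"
    using assms by (intro has_sum_cmult_left)
  show "((\<lambda>y. case (x, y) of (x, y) \<Rightarrow> f x * g y) has_sum f x * b) B" for x
    using assms by (auto intro!: has_sum_cmult_right)
  have "(\<lambda>u. norm ((\<lambda>(x, y). f x * g y) u)) summable_on A \<times> B"
    by (rule Infinite_Sum.abs_summable_on_Sigma_iff[THEN iffD2])
       (use assms in \<open>auto simp: norm_mult infsum_cmult_right' abs_mult intro!: summable_on_cmult_right summable_on_cmult_left\<close>)
  then show "(\<lambda>(x, y). f x * g y) summable_on A \<times> B"
    by (rule Infinite_Sum.abs_summable_summable)
qed

subsection \<open>The Jacobi triple product\<close>

definition theta_term :: "complex \<Rightarrow> complex \<Rightarrow> int \<Rightarrow> complex" where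
  "theta_term p z n = z powi n * p powi (n\<^sup>2)"

definition theta :: "complex \<Rightarrow> complex \<Rightarrow> complex" where
  "theta p z = (\<Sum>\<^sub>\<infinity>n. theta_term p z n)"

text \<open>The quadratic exponent beats any geometric growth: the term is
  \<open>(x * y ^ n) ^ n\<close>, and \<open>x * y ^ n\<close> is eventually below 1/2 however large
  \<open>x\<close> is.\<close>

lemma summable_power_square:
  fixes x y :: real
  assumes "0 \<le> x" "0 \<le> y" "y < 1"
  shows "summable (\<lambda>n. x ^ n * y ^ n\<^sup>2)"
proof (rule summable_comparison_test_ev)
  have "(\<lambda>n. x * y ^ n) \<longlonglongrightarrow> x * 0"
    by (intro tendsto_intros LIMSEQ_power_zero) (use assms in auto)
  then have "eventually (\<lambda>n. x * y ^ n < 1/2) sequentially"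
    by (rule order_tendstoD) auto
  then show "eventually (\<lambda>n. norm (x ^ n * y ^ n\<^sup>2) \<le> (1/2) ^ n) sequentially"
  proof eventually_elim
    case (elim n)
    have "x ^ n * y ^ n\<^sup>2 = (x * y ^ n) ^ n"
      by (simp add: power_mult_distrib power_mult power2_eq_square)
    also have "\<dots> \<le> (1/2) ^ n"
      using elim assms by (intro power_mono) auto
    finally show ?case using assms by simp
  qed
qed (auto intro: summable_geometric)

text \<open>Negating the index replaces \<open>z\<close> by \<open>inverse z\<close>, so the bound
  for non-negative indices, proved for every \<open>z\<close>, also covers the negative
  half.\<close>

lemma theta_term_abs_summable:
  assumes "norm p < 1"
  shows "(\<lambda>n. norm (theta_term p z n)) summable_on UNIV"
proof -
  have *: "(\<lambda>n::nat. norm (theta_term p z (int n))) summable_on UNIV" for z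
  proof -
    have "norm (theta_term p z (int n)) = norm z ^ n * norm p ^ n\<^sup>2" for n
      by (simp add: theta_term_def norm_mult norm_power flip: of_nat_power)
    then have "summable (\<lambda>n. norm (theta_term p z (int n)))"
      using summable_power_square[of "norm z" "norm p"] assms by simp
    then show ?thesis
      by (subst summable_on_UNIV_nonneg_real_iff) auto
  qed
  have nonneg: "(\<lambda>n. norm (theta_term p z n)) summable_on range int"
    using *[of z] by (subst summable_on_reindex) (auto simp: o_def)
  have "theta_term p (inverse z) n = theta_term p z (- n)" for n
    by (simp add: theta_term_def power_int_inverse power_int_minus)
  then have "(\<lambda>n. norm (theta_term p z n)) summable_on range (\<lambda>n. - int n)"
    using *[of "inverse z"] by (subst summable_on_reindex) (auto simp: o_def inj_on_def)
  then have "(\<lambda>n. norm (theta_term p z n)) summable_on (range int \<union> range (\<lambda>n. - int n))"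
    by (rule summable_on_union[OF nonneg])
  moreover have "range int \<union> range (\<lambda>n. - int n) = UNIV"
  proof -
    have "m \<in> range int \<union> range (\<lambda>n. - int n)" for m
      by (cases m rule: int_cases2) auto
    then show ?thesis by blast
  qed
  ultimately show ?thesis by simp
qed

lemma theta_has_sum:
  assumes "norm p < 1"
  shows "(theta_term p z has_sum theta p z) UNIV"
  unfolding theta_def
  using Infinite_Sum.abs_summable_summable[OF theta_term_abs_summable[OF assms]] by (rule has_sum_infsum)

lemma theta_inverse:
  "theta p (inverse z) = theta p z"
  unfolding theta_def
  by (rule infsum_reindex_bij_witness[of _ uminus uminus])
     (auto simp: theta_term_def power_int_inverse power_int_minus)

text \<open>
  With the value 0 for negative \<open>m\<close>, the recurrence \<open>inv_qpoch_rec\<close> holds for all integers,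
  which removes all boundary cases from the finite form of the triple product.
\<close>
definition inv_qpoch :: "complex \<Rightarrow> int \<Rightarrow> complex" where
  "inv_qpoch q m = (if m < 0 then 0 else inverse (\<Prod>i<nat m. 1 - q ^ Suc i))"

lemma one_minus_power_nonzero:
  fixes q :: complex
  assumes "norm q < 1"
  shows "1 - q ^ Suc i \<noteq> 0"
proof
  assume "1 - q ^ Suc i = 0"
  then have "norm q ^ Suc i = 1"
    by (metis eq_iff_diff_eq_0 norm_one norm_power)
  moreover have "norm q ^ Suc i < 1"
    using assms by (simp add: power_less_one_iff del: power_Suc)
  ultimately show False by simp
qed

lemma inv_qpoch_rec:
  assumes "norm q < 1" "q \<noteq> 0"
  shows "inv_qpoch q (m - 1) = (1 - q powi m) * inv_qpoch q m"
proof (cases "m > 0")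
  case True
  then obtain k where m: "m = int (Suc k)"
    by (metis Suc_pred' nat_int_comparison(2) of_nat_0 zero_less_imp_eq_int)
  have "nat m = Suc k" "nat (m - 1) = k" "q powi m = q ^ Suc k"
    unfolding m by (simp_all add: nat_add_distrib flip: power_int_of_nat)
  then show ?thesis
    using True one_minus_power_nonzero[OF assms(1), of k]
    by (simp add: inv_qpoch_def)
next
  case False
  \<comment> \<open>For \<open>m = 0\<close> the factor \<open>1 - q powi m\<close> vanishes; for
    \<open>m < 0\<close> both values of \<open>inv_qpoch\<close> are 0.\<close>
  then show ?thesis by (auto simp: inv_qpoch_def)
qed

section \<open>The finite form of the triple product\<close>

text \<open>\<open>c n k\<close> is the q-binomial coefficient of \<open>2n\<close> over
  \<open>n + k\<close>, and the recurrence amounts to two q-Pascal steps. It is what comparing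
  coefficients demands when the finite product gains its two factors of index
  \<open>n\<close>.\<close>

lemma finite_jacobi_coeff_rec:
  fixes q :: complex
  assumes q: "norm q < 1" "q \<noteq> 0"
  defines "c \<equiv> \<lambda>n k. (\<Prod>i<2*n. 1 - q ^ Suc i) * inv_qpoch q (int n + k) * inv_qpoch q (int n - k)"
  shows "c (Suc n) k = (1 + q ^ (2 * n + 1)) * c n k
    + q powi (int n + 1 - k) * c n (k - 1) + q powi (int n + 1 + k) * c n (k + 1)"
proof -
  \<comment> \<open>\<open>a\<close> and \<open>b\<close> are the largest arguments of
    \<open>inv_qpoch\<close> that occur, those of \<open>c (Suc n) k\<close>. Lowering all others
    from them makes \<open>R\<close> a common factor and leaves a rational identity in
    \<open>x\<close>, \<open>y\<close> and \<open>q\<close>.\<close>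
  define a b where "a = int n + 1 + k" and "b = int n + 1 - k"
  define x y where "x = q powi a" and "y = q powi b"
  define R where "R = inv_qpoch q a * inv_qpoch q b"
  have xy: "x * y = q ^ (2 * n + 2)"
  proof -
    have "x * y = q powi (a + b)" using q by (simp add: x_def y_def power_int_add)
    also have "a + b = int (2 * n + 2)" by (simp add: a_def b_def)
    finally show ?thesis by (simp only: power_int_of_nat)
  qed
  have xyw: "q ^ (2 * n + 1) = x * y / q" using q by (simp add: xy)
  have r: "inv_qpoch q (m - 2) = (1 - q powi m / q) * (1 - q powi m) * inv_qpoch q m" for m
    using inv_qpoch_rec[OF q, of "m - 1"] inv_qpoch_rec[OF q, of m] q
    by (simp add: power_int_diff)
  have c1: "c (Suc n) k = (\<Prod>i<2*n. 1 - q ^ Suc i) * (1 - x * y / q) * (1 - x * y) * R"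
    unfolding xyw[symmetric] xy
    by (simp add: c_def R_def a_def b_def algebra_simps)
  have c2: "c n k = (\<Prod>i<2*n. 1 - q ^ Suc i) * (1 - x) * (1 - y) * R"
    using inv_qpoch_rec[OF q, of a] inv_qpoch_rec[OF q, of b]
    by (simp add: c_def R_def a_def b_def x_def y_def)
  have c3: "c n (k - 1) = (\<Prod>i<2*n. 1 - q ^ Suc i) * (1 - x / q) * (1 - x) * R"
  proof -
    have "int n + (k - 1) = a - 2" "int n - (k - 1) = b" by (simp_all add: a_def b_def)
    then show ?thesis by (simp only: c_def r R_def x_def mult_ac)
  qed
  have c4: "c n (k + 1) = (\<Prod>i<2*n. 1 - q ^ Suc i) * (1 - y / q) * (1 - y) * R"
  proof -
    have "int n + (k + 1) = a" "int n - (k + 1) = b - 2" by (simp_all add: a_def b_def)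
    then show ?thesis by (simp only: c_def r R_def y_def mult_ac)
  qed
  have *: "(1 - x * y / q) * (1 - x * y) =
    (1 + x * y / q) * ((1 - x) * (1 - y)) + y * ((1 - x / q) * (1 - x)) + x * ((1 - y / q) * (1 - y))"
    using q by (simp add: field_simps)
  have "c (Suc n) k = ((\<Prod>i<2*n. 1 - q ^ Suc i) * R) * ((1 - x * y / q) * (1 - x * y))"
    unfolding c1 by (simp only: mult_ac)
  also have "\<dots> = (1 + x * y / q) * c n k + y * c n (k - 1) + x * c n (k + 1)"
    unfolding * c2 c3 c4 by (simp only: distrib_left distrib_right mult_ac)
  finally show ?thesis
    unfolding xyw x_def y_def a_def b_def .
qed

text \<open>Induction on \<open>n\<close>: the new factors multiply out to a constant term and
  multiples of \<open>z\<close> and \<open>1/z\<close>, and the latter two shift the index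
  \<open>k\<close> by one. Since \<open>c n k\<close> is 0 for \<open>k\<close> outside
  \<open>-n..n\<close>, the sum is a Laurent polynomial in \<open>z\<close>, and summing over all
  integers lets it be shifted freely.\<close>

lemma finite_jacobi_triple_product:
  fixes p z :: complex
  assumes p: "norm p < 1" "p \<noteq> 0" and z: "z \<noteq> 0"
  defines "c \<equiv> \<lambda>n k. (\<Prod>i<2*n. 1 - (p\<^sup>2) ^ Suc i) * inv_qpoch (p\<^sup>2) (int n + k) * inv_qpoch (p\<^sup>2) (int n - k)"
  shows "((\<lambda>k. theta_term p z k * c n k) has_sum
    (\<Prod>i<n. (1 + z * p ^ (2 * i + 1)) * (1 + p ^ (2 * i + 1) / z))) UNIV"
proof (induction n)
  case 0
  show ?case
    by (rule has_sum_finite_neutralI[of "{0}"])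
       (auto simp: c_def inv_qpoch_def theta_term_def)
next
  case (Suc n)
  define P where "P = (\<Prod>i<n. (1 + z * p ^ (2 * i + 1)) * (1 + p ^ (2 * i + 1) / z))"
  define f where "f = (\<lambda>k. theta_term p z k * c n k)"
  have f: "(f has_sum P) UNIV"
    using Suc by (simp add: P_def f_def)
  have fm: "((\<lambda>k. f (k - 1)) has_sum P) UNIV"
    using f by (subst has_sum_reindex_bij_witness[of UNIV "\<lambda>k. k + 1" "\<lambda>k. k - 1" UNIV f _ P P]) auto
  have fp: "((\<lambda>k. f (k + 1)) has_sum P) UNIV"
    using f by (subst has_sum_reindex_bij_witness[of UNIV "\<lambda>k. k - 1" "\<lambda>k. k + 1" UNIV f _ P P]) auto
  have q: "norm (p\<^sup>2) < 1" "p\<^sup>2 \<noteq> 0"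
    using p by (auto simp: norm_power power_less_one_iff)
  have rec: "c (Suc n) k = (1 + (p\<^sup>2) ^ (2 * n + 1)) * c n k
    + p\<^sup>2 powi (int n + 1 - k) * c n (k - 1) + p\<^sup>2 powi (int n + 1 + k) * c n (k + 1)" for k
    unfolding c_def by (rule finite_jacobi_coeff_rec[OF q])
  \<comment> \<open>Since \<open>(k - 1)^2 + (2n + 1) = k^2 + 2(n + 1 - k)\<close>, the shift by one
    produces exactly the weight in the coefficient recurrence; \<open>p'\<close> is the mirror
    image.\<close>
  have m: "theta_term p z (k - 1) * (z * p ^ (2 * n + 1)) = theta_term p z k * p\<^sup>2 powi (int n + 1 - k)" for k
  proof -
    have "p powi ((k - 1)\<^sup>2) * p ^ (2 * n + 1) = p powi ((k - 1)\<^sup>2 + int (2 * n + 1))"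
      using p by (simp only: power_int_add power_int_of_nat simp_thms)
    also have "(k - 1)\<^sup>2 + int (2 * n + 1) = k\<^sup>2 + 2 * (int n + 1 - k)"
      by (simp add: power2_eq_square algebra_simps)
    also have "p powi \<dots> = p powi (k\<^sup>2) * p\<^sup>2 powi (int n + 1 - k)"
      using p by (simp add: power_int_add power_int_power)
    finally have "p powi ((k - 1)\<^sup>2) * p ^ (2 * n + 1) = p powi (k\<^sup>2) * p\<^sup>2 powi (int n + 1 - k)" .
    moreover have "z powi (k - 1) * z = z powi k"
      using z by (simp add: power_int_minus_mult)
    ultimately have "(z powi (k - 1) * z) * (p powi ((k - 1)\<^sup>2) * p ^ (2 * n + 1)) =
      z powi k * (p powi (k\<^sup>2) * p\<^sup>2 powi (int n + 1 - k))"
      by (simp only:)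
    then show ?thesis
      unfolding theta_term_def by (simp only: mult_ac)
  qed
  have p': "theta_term p z (k + 1) * (p ^ (2 * n + 1) / z) = theta_term p z k * p\<^sup>2 powi (int n + 1 + k)" for k
  proof -
    have "p powi ((k + 1)\<^sup>2) * p ^ (2 * n + 1) = p powi ((k + 1)\<^sup>2 + int (2 * n + 1))"
      using p by (simp only: power_int_add power_int_of_nat simp_thms)
    also have "(k + 1)\<^sup>2 + int (2 * n + 1) = k\<^sup>2 + 2 * (int n + 1 + k)"
      by (simp add: power2_eq_square algebra_simps)
    also have "p powi \<dots> = p powi (k\<^sup>2) * p\<^sup>2 powi (int n + 1 + k)"
      using p by (simp add: power_int_add[of p "k\<^sup>2"] power_int_power)
    finally have "p powi ((k + 1)\<^sup>2) * p ^ (2 * n + 1) = p powi (k\<^sup>2) * p\<^sup>2 powi (int n + 1 + k)" .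
    moreover have "z powi (k + 1) / z = z powi k"
      using z by (simp add: power_int_add_1)
    ultimately have "(z powi (k + 1) / z) * (p powi ((k + 1)\<^sup>2) * p ^ (2 * n + 1)) =
      z powi k * (p powi (k\<^sup>2) * p\<^sup>2 powi (int n + 1 + k))"
      by (simp only:)
    then show ?thesis
      unfolding theta_term_def divide_inverse by (simp only: mult_ac)
  qed
  have eq: "theta_term p z k * c (Suc n) k = f k * (1 + (p\<^sup>2) ^ (2 * n + 1))
     + f (k - 1) * (z * p ^ (2 * n + 1)) + f (k + 1) * (p ^ (2 * n + 1) / z)" for k
  proof -
    have "f (k - 1) * (z * p ^ (2 * n + 1)) = theta_term p z k * p\<^sup>2 powi (int n + 1 - k) * c n (k - 1)"
      unfolding f_def m[symmetric] by (simp only: mult_ac)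
    moreover have "f (k + 1) * (p ^ (2 * n + 1) / z) = theta_term p z k * p\<^sup>2 powi (int n + 1 + k) * c n (k + 1)"
      unfolding f_def p'[symmetric] by (simp only: mult_ac)
    ultimately show ?thesis
      unfolding rec f_def by (simp only: ring_distribs mult_ac)
  qed
  have "((\<lambda>k. theta_term p z k * c (Suc n) k) has_sum
    (P * (1 + (p\<^sup>2) ^ (2 * n + 1)) + P * (z * p ^ (2 * n + 1)) + P * (p ^ (2 * n + 1) / z))) UNIV"
    unfolding eq by (intro has_sum_add has_sum_cmult_left f fm fp)
  also have "P * (1 + (p\<^sup>2) ^ (2 * n + 1)) + P * (z * p ^ (2 * n + 1)) + P * (p ^ (2 * n + 1) / z)
    = P * ((1 + z * p ^ (2 * n + 1)) * (1 + p ^ (2 * n + 1) / z))"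
  proof -
    have "(p\<^sup>2) ^ (2 * n + 1) = p ^ (2 * n + 1) * p ^ (2 * n + 1)"
      by (metis power2_eq_square power_mult_distrib)
    then show ?thesis using z by (simp add: field_simps)
  qed
  finally show ?case by (simp add: P_def)
qed

section \<open>Passage to the infinite product\<close>

lemma qpoch_inf_LIMSEQ:
  assumes "norm q < 1"
  shows "(\<lambda>n. \<Prod>i<n. 1 - a * q ^ i) \<longlonglongrightarrow> qpoch_inf a q"
  by (rule has_prod_imp_tendsto'[OF has_prod_qpoch_inf[OF assms]])

lemma qpoch_inf_eq_0_iff:
  assumes "norm q < 1"
  shows "qpoch_inf a q = 0 \<longleftrightarrow> (\<exists>i. a * q ^ i = 1)"
  using has_prod_eq_0_iff[OF has_prod_qpoch_inf[OF assms, of a]] by auto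

lemma qpoch_inf_nonzero:
  assumes "norm q < 1" "norm a < 1"
  shows "qpoch_inf a q \<noteq> 0"
proof
  assume "qpoch_inf a q = 0"
  then obtain i where "a * q ^ i = 1"
    using assms by (auto simp: qpoch_inf_eq_0_iff)
  then have "norm a * norm q ^ i = 1"
    by (metis norm_mult norm_one norm_power)
  moreover have "norm a * norm q ^ i \<le> norm a * 1"
    using assms by (intro mult_left_mono power_le_one) auto
  ultimately show False using assms by simp
qed

text \<open>Let \<open>n\<close> tend to infinity in the finite form. Each coefficient
  \<open>c n k\<close> tends to \<open>1/Q\<close>, and the coefficients are bounded uniformly in
  \<open>n\<close> and \<open>k\<close>, so dominated convergence applies with a multiple of
  \<open>norm (theta_term p z k)\<close> as majorant.\<close>

lemma jacobi_triple_product: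
  fixes p z :: complex
  assumes p: "norm p < 1" "p \<noteq> 0" and z: "z \<noteq> 0"
  shows "theta p z = qpoch_inf (p\<^sup>2) (p\<^sup>2) * qpoch_inf (- z * p) (p\<^sup>2) * qpoch_inf (- p / z) (p\<^sup>2)"
proof -
  define q where "q = p\<^sup>2"
  define Q where "Q = qpoch_inf q q"
  define c where "c = (\<lambda>n k. (\<Prod>i<2*n. 1 - q ^ Suc i) * inv_qpoch q (int n + k) * inv_qpoch q (int n - k))"
  have q: "norm q < 1"
    using p by (auto simp: q_def norm_power power_less_one_iff)
  have Q0: "Q \<noteq> 0"
    using qpoch_inf_nonzero q by (simp add: Q_def)
  have lim: "(\<lambda>n. \<Prod>i<n. 1 - q ^ Suc i) \<longlonglongrightarrow> Q"
    using qpoch_inf_LIMSEQ[OF q, of q] by (simp add: Q_def)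
  then have lim_inv: "(\<lambda>n. inv_qpoch q (int n)) \<longlonglongrightarrow> inverse Q"
    using tendsto_inverse[OF lim Q0] by (simp add: inv_qpoch_def)
  obtain C where C: "norm (\<Prod>i<n. 1 - q ^ Suc i) \<le> C" for n
    using convergent_imp_Bseq[OF convergentI[OF lim]] by (auto simp: Bseq_def)
  obtain D where D: "D > 0" "norm (inv_qpoch q (int n)) \<le> D" for n
    using convergent_imp_Bseq[OF convergentI[OF lim_inv]] by (auto simp: Bseq_def)
  \<comment> \<open>The value 0 at negative arguments makes the bound uniform over all
    integers.\<close>
  have D': "norm (inv_qpoch q m) \<le> D" for m
    using D(2)[of "nat m"] D(1) by (cases "m < 0") (auto simp: inv_qpoch_def)
  \<comment> \<open>For fixed \<open>k\<close> the argument \<open>int n + k\<close> is eventually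
    non-negative, so truncation by \<open>nat\<close> does not affect the limit.\<close>
  have lim_inv': "(\<lambda>n. inv_qpoch q (int n + k)) \<longlonglongrightarrow> inverse Q" for k
  proof -
    have "filterlim (\<lambda>n. nat (int n + k)) at_top sequentially"
      unfolding filterlim_at_top
    proof
      fix Z
      show "\<forall>\<^sub>F n in sequentially. Z \<le> nat (int n + k)"
        by (rule eventually_sequentiallyI[of "Z + nat \<bar>k\<bar>"]) linarith
    qed
    from filterlim_compose[OF lim_inv this]
    have "(\<lambda>n. inv_qpoch q (int (nat (int n + k)))) \<longlonglongrightarrow> inverse Q" .
    moreover have "\<forall>\<^sub>F n in sequentially. inv_qpoch q (int (nat (int n + k))) = inv_qpoch q (int n + k)"
      by (rule eventually_sequentiallyI[of "nat \<bar>k\<bar>"]) (auto intro!: arg_cong[where f = "inv_qpoch q"])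
    ultimately show ?thesis
      by (rule Lim_transform_eventually)
  qed
  have c_lim: "(\<lambda>n. c n k) \<longlonglongrightarrow> Q * inverse Q * inverse Q" for k
  proof -
    have "(\<lambda>n. \<Prod>i<2*n. 1 - q ^ Suc i) \<longlonglongrightarrow> Q"
      using filterlim_compose[OF lim filterlim_subseq[of "\<lambda>n. 2 * n"]] by (simp add: strict_mono_def)
    then show ?thesis
      unfolding c_def
      using lim_inv'[of k] lim_inv'[of "- k"] by (intro tendsto_mult) simp_all
  qed
  have c_bound: "norm (c n k) \<le> C * D * D" for n k
    unfolding c_def norm_mult using C D' D(1) C[of 0]
    by (intro mult_mono mult_nonneg_nonneg) (auto intro: order_trans[OF norm_ge_zero])
  have "(\<lambda>n. \<Prod>i<n. (1 + z * p ^ (2 * i + 1)) * (1 + p ^ (2 * i + 1) / z))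
    \<longlonglongrightarrow> (\<Sum>\<^sub>\<infinity>k. theta_term p z k * (Q * inverse Q * inverse Q))"
  proof (rule tendsto_infsum_dominated)
    show "((\<lambda>k. theta_term p z k * c n k) has_sum
      (\<Prod>i<n. (1 + z * p ^ (2 * i + 1)) * (1 + p ^ (2 * i + 1) / z))) UNIV" for n
      using finite_jacobi_triple_product[OF p z, of n] by (simp add: c_def q_def)
    show "(\<lambda>n. theta_term p z k * c n k) \<longlonglongrightarrow> theta_term p z k * (Q * inverse Q * inverse Q)" for k
      by (intro tendsto_intros c_lim)
    show "norm (theta_term p z k * c n k) \<le> norm (theta_term p z k) * (C * D * D)" for n k
      unfolding norm_mult by (intro mult_left_mono c_bound) auto
    show "(\<lambda>k. norm (theta_term p z k) * (C * D * D)) summable_on UNIV"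
      by (intro summable_on_cmult_left theta_term_abs_summable p)
  qed
  also have "(\<Sum>\<^sub>\<infinity>k. theta_term p z k * (Q * inverse Q * inverse Q)) = theta p z / Q"
    using Q0 unfolding infsum_cmult_left' theta_def[symmetric] by (simp add: divide_inverse)
  finally have "(\<lambda>n. \<Prod>i<n. (1 + z * p ^ (2 * i + 1)) * (1 + p ^ (2 * i + 1) / z)) \<longlonglongrightarrow> theta p z / Q" .
  moreover have "1 - - z * p * q ^ i = 1 + z * p ^ (2 * i + 1)"
    "1 - - p / z * q ^ i = 1 + p ^ (2 * i + 1) / z" for i
    by (simp_all add: q_def power_mult)
  then have "(\<lambda>n. \<Prod>i<n. (1 + z * p ^ (2 * i + 1)) * (1 + p ^ (2 * i + 1) / z))
    \<longlonglongrightarrow> qpoch_inf (- z * p) q * qpoch_inf (- p / z) q"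
    using tendsto_mult[OF qpoch_inf_LIMSEQ[OF q, of "- z * p"] qpoch_inf_LIMSEQ[OF q, of "- p / z"]]
    by (simp only: prod.distrib)
  ultimately have "theta p z / Q = qpoch_inf (- z * p) q * qpoch_inf (- p / z) q"
    by (rule LIMSEQ_unique)
  then have "theta p z = Q * (qpoch_inf (- z * p) q * qpoch_inf (- p / z) q)"
    using Q0 by (metis nonzero_mult_div_cancel_left times_divide_eq_right)
  then show ?thesis
    by (simp only: Q_def q_def mult.assoc)
qed

subsection \<open>Products of theta functions\<close>

lemma theta_mult_has_sum:
  assumes "norm P < 1"
  shows "((\<lambda>(m, n). theta_term P x m * theta_term P y n) has_sum (theta P x * theta P y)) UNIV"
  using has_sum_times[OF theta_term_abs_summable[OF assms] theta_term_abs_summable[OF assms]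
      theta_has_sum[OF assms] theta_has_sum[OF assms], of x y]
  by simp

text \<open>The index pairs with even sum form a lattice with the orthogonal basis (1,1), (1,-1) of
  squared length 2, so the double series over them factors into two theta functions of nome
  \<open>P\<^sup>2\<close>. The odd pairs are its translate by (1,0), which contributes the
  prefactor \<open>x * P\<close> and a factor \<open>P\<^sup>2\<close> in each argument.\<close>

lemma theta_mult_parity:
  assumes P: "norm P < 1" "P \<noteq> 0" and xy: "x \<noteq> 0" "y \<noteq> 0"
  shows "theta P x * theta P y = theta (P\<^sup>2) (x * y) * theta (P\<^sup>2) (x / y)
    + x * P * theta (P\<^sup>2) (x * y * P\<^sup>2) * theta (P\<^sup>2) (x * P\<^sup>2 / y)"
proof -
  have P2: "norm (P\<^sup>2) < 1"
    using P by (auto simp: norm_power power_less_one_iff)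
  define F where "F = (\<lambda>(m, n). theta_term P x m * theta_term P y n)"
  define g0 g1 :: "int \<times> int \<Rightarrow> int \<times> int"
    where "g0 = (\<lambda>(r, s). (r + s, r - s))" and "g1 = (\<lambda>(r, s). (r + s + 1, r - s))"
  have F0: "F (g0 (r, s)) = theta_term (P\<^sup>2) (x * y) r * theta_term (P\<^sup>2) (x / y) s" for r s
  proof -
    have "P powi ((r + s)\<^sup>2) * P powi ((r - s)\<^sup>2) = P powi ((r + s)\<^sup>2 + (r - s)\<^sup>2)"
      using P by (simp add: power_int_add)
    also have "(r + s)\<^sup>2 + (r - s)\<^sup>2 = 2 * r\<^sup>2 + 2 * s\<^sup>2"
      by (simp add: power2_eq_square algebra_simps)
    also have "P powi \<dots> = (P\<^sup>2) powi (r\<^sup>2) * (P\<^sup>2) powi (s\<^sup>2)"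
      using P by (simp add: power_int_add power_int_power)
    finally show ?thesis
      using xy
      by (simp add: F_def g0_def theta_term_def power_int_add power_int_diff power_int_mult_distrib
          power_int_divide_distrib)
  qed
  have F1: "F (g1 (r, s)) = x * P * (theta_term (P\<^sup>2) (x * y * P\<^sup>2) r * theta_term (P\<^sup>2) (x * P\<^sup>2 / y) s)" for r s
  proof -
    have "P powi ((r + s + 1)\<^sup>2) * P powi ((r - s)\<^sup>2) = P powi ((r + s + 1)\<^sup>2 + (r - s)\<^sup>2)"
      using P by (simp add: power_int_add)
    also have "(r + s + 1)\<^sup>2 + (r - s)\<^sup>2 = 2 * r\<^sup>2 + 2 * s\<^sup>2 + 2 * r + 2 * s + 1"
      by (simp add: power2_eq_square algebra_simps)
    also have "P powi \<dots> = (P\<^sup>2) powi (r\<^sup>2) * (P\<^sup>2) powi (s\<^sup>2) * (P\<^sup>2) powi r * (P\<^sup>2) powi s * P"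
      using P by (simp add: power_int_add power_int_power)
    finally show ?thesis
      using xy
      by (simp add: F_def g1_def theta_term_def power_int_add power_int_diff power_int_mult_distrib
          power_int_divide_distrib)
  qed
  have "((\<lambda>(r, s). F (g0 (r, s))) has_sum (theta (P\<^sup>2) (x * y) * theta (P\<^sup>2) (x / y))) UNIV"
    using theta_mult_has_sum[OF P2, of "x * y" "x / y"] F0 by (simp add: case_prod_unfold)
  then have S0: "(F has_sum (theta (P\<^sup>2) (x * y) * theta (P\<^sup>2) (x / y))) (range g0)"
    by (subst has_sum_reindex) (auto simp: o_def inj_on_def case_prod_unfold g0_def)
  have "((\<lambda>(r, s). F (g1 (r, s))) has_sum (x * P * (theta (P\<^sup>2) (x * y * P\<^sup>2) * theta (P\<^sup>2) (x * P\<^sup>2 / y)))) UNIV"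
    using has_sum_cmult_right[OF theta_mult_has_sum[OF P2, of "x * y * P\<^sup>2" "x * P\<^sup>2 / y"], of "x * P"] F1
    by (simp add: case_prod_unfold)
  then have S1: "(F has_sum (x * P * (theta (P\<^sup>2) (x * y * P\<^sup>2) * theta (P\<^sup>2) (x * P\<^sup>2 / y)))) (range g1)"
    by (subst has_sum_reindex) (auto simp: o_def inj_on_def case_prod_unfold g1_def)
  have disj: "range g0 \<inter> range g1 = {}"
    by (auto simp: g0_def g1_def) presburger
  have cover: "range g0 \<union> range g1 = UNIV"
  proof -
    have "(m, n) \<in> range g0 \<union> range g1" for m n
    proof (cases "even (m + n)")
      case True
      then have "(m, n) = g0 ((m + n) div 2, (m - n) div 2)"
        by (auto simp: g0_def) presburger+
      then show ?thesis by blast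
    next
      case False
      then have "(m, n) = g1 ((m + n - 1) div 2, (m - n - 1) div 2)"
        by (auto simp: g1_def) presburger+
      then show ?thesis by blast
    qed
    then show ?thesis by auto
  qed
  have "(F has_sum (theta P x * theta P y)) UNIV"
    unfolding F_def by (rule theta_mult_has_sum[OF P(1)])
  with has_sum_Un_disjoint[OF S0 S1 disj] show ?thesis
    unfolding cover by (simp add: has_sum_unique mult.assoc)
qed

text \<open>
  The pairs \<open>(2s - t, s + 2t)\<close> form the ideal \<open>(2 + i)\<close> of the Gaussian integers, of index 5, and the
  five offsets \<open>(a, b)\<close> represent its cosets.
\<close>
lemma theta_mult_mod5:
  assumes P: "norm P < 1" "P \<noteq> 0" and xy: "x \<noteq> 0" "y \<noteq> 0"
  shows "theta P x * theta P y =
    (\<Sum>(a, b)\<in>{(0, 0), (-1, 0), (0, -1), (-1, -1), (0, 1)}.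
      x powi a * y powi b * P powi (a\<^sup>2 + b\<^sup>2) *
      (theta (P ^ 5) (x\<^sup>2 * y * P powi (4 * a + 2 * b)) * theta (P ^ 5) (y\<^sup>2 / x * P powi (4 * b - 2 * a))))"
    (is "_ = (\<Sum>(a, b)\<in>?I. ?T a b)")
proof -
  have P5: "norm (P ^ 5) < 1"
    using P by (auto simp: norm_power power_less_one_iff)
  define F where "F = (\<lambda>(m, n). theta_term P x m * theta_term P y n)"
  define g :: "int \<times> int \<Rightarrow> int \<times> int \<Rightarrow> int \<times> int"
    where "g = (\<lambda>(a, b) (s, t). (2 * s - t + a, s + 2 * t + b))"
  have Fg: "F (g (a, b) (s, t)) = x powi a * y powi b * P powi (a\<^sup>2 + b\<^sup>2) *
     (theta_term (P ^ 5) (x\<^sup>2 * y * P powi (4 * a + 2 * b)) s *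
      theta_term (P ^ 5) (y\<^sup>2 / x * P powi (4 * b - 2 * a)) t)" for a b s t
  proof -
    have "P powi ((2 * s - t + a)\<^sup>2) * P powi ((s + 2 * t + b)\<^sup>2) =
      P powi ((2 * s - t + a)\<^sup>2 + (s + 2 * t + b)\<^sup>2)"
      using P by (simp add: power_int_add)
    \<comment> \<open>There is no term in \<open>s * t\<close>, because the basis vectors (2,1) and
      (-1,2) are orthogonal; their squared length 5 yields the nome \<open>P ^ 5\<close>.\<close>
    also have "(2 * s - t + a)\<^sup>2 + (s + 2 * t + b)\<^sup>2 =
      (a\<^sup>2 + b\<^sup>2) + 5 * s\<^sup>2 + (4 * a + 2 * b) * s + 5 * t\<^sup>2 + (4 * b - 2 * a) * t"
      by (simp add: power2_eq_square algebra_simps)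
    also have "P powi \<dots> = P powi (a\<^sup>2 + b\<^sup>2) * (P ^ 5) powi (s\<^sup>2) * (P powi (4 * a + 2 * b)) powi s
      * (P ^ 5) powi (t\<^sup>2) * (P powi (4 * b - 2 * a)) powi t"
      using P by (simp add: power_int_add[of P "_ + _" "_ * _"] power_int_add[of P "_\<^sup>2 + _" "_ * _"] power_int_power flip: power_int_mult)
    finally have 1: "P powi ((2 * s - t + a)\<^sup>2) * P powi ((s + 2 * t + b)\<^sup>2) = \<dots>" .
    have 2: "x powi (2 * s - t + a) = (x\<^sup>2) powi s / x powi t * x powi a"
      using xy by (simp add: power_int_add power_int_diff power_int_power)
    have 3: "y powi (s + 2 * t + b) = y powi s * (y\<^sup>2) powi t * y powi b"
      using xy by (simp add: power_int_add power_int_diff power_int_power)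
    have "F (g (a, b) (s, t)) = x powi (2 * s - t + a) * y powi (s + 2 * t + b) *
        (P powi ((2 * s - t + a)\<^sup>2) * P powi ((s + 2 * t + b)\<^sup>2))"
      by (simp add: F_def g_def theta_term_def)
    also have "\<dots> = x powi a * y powi b * P powi (a\<^sup>2 + b\<^sup>2) *
     (theta_term (P ^ 5) (x\<^sup>2 * y * P powi (4 * a + 2 * b)) s *
      theta_term (P ^ 5) (y\<^sup>2 / x * P powi (4 * b - 2 * a)) t)"
      unfolding 1 unfolding 2 3 theta_term_def power_int_mult_distrib power_int_divide_distrib
      by (simp add: mult_ac)
    finally show ?thesis .
  qed
  have S: "(F has_sum ?T a b) (range (g (a, b)))" for a b
  proof -
    have "((\<lambda>(s, t). F (g (a, b) (s, t))) has_sum ?T a b) UNIV"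
      using has_sum_cmult_right[OF theta_mult_has_sum[OF P5]] unfolding Fg
      by (simp only: case_prod_unfold)
    then show ?thesis
      by (subst has_sum_reindex) (auto simp: o_def inj_on_def case_prod_unfold g_def)
  qed
  \<comment> \<open>The functional \<open>m - 2n\<close> takes the value \<open>-5t\<close> at
    \<open>(2s - t, s + 2t)\<close>, so its residue modulo 5 identifies the coset.\<close>
  have range_g: "range (g (a, b)) = {(m, n). (m - 2 * n) mod 5 = (a - 2 * b) mod 5}" for a b
  proof (intro equalityI subsetI)
    fix u assume "u \<in> range (g (a, b))"
    then obtain s t where u: "u = (2 * s - t + a, s + 2 * t + b)" by (auto simp: g_def)
    have "(2 * s - t + a) - 2 * (s + 2 * t + b) = (a - 2 * b) + 5 * (- t)" by simp
    then show "u \<in> {(m, n). (m - 2 * n) mod 5 = (a - 2 * b) mod 5}"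
      unfolding u mem_Collect_eq prod.case by (metis mod_mult_self2)
  next
    fix u assume "u \<in> {(m, n). (m - 2 * n) mod 5 = (a - 2 * b) mod 5}"
    then obtain m n where u: "u = (m, n)" "(m - 2 * n) mod 5 = (a - 2 * b) mod 5" by auto
    then obtain k where "(m - 2 * n) = (a - 2 * b) + 5 * k"
      by (metis mod_eqE mult.commute)
    \<comment> \<open>Comparing \<open>-5t\<close> with \<open>5k\<close> gives
      \<open>t = -k\<close>; the second coordinate then determines \<open>s\<close>.\<close>
    then have "u = g (a, b) (n - b + 2 * k, - k)"
      unfolding u g_def by simp
    then show "u \<in> range (g (a, b))" by blast
  qed
  have "(F has_sum (\<Sum>i\<in>?I. case_prod ?T i)) (\<Union>i\<in>?I. range (g i))"
  proof (rule sum_has_sum)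
    show "(F has_sum (case i of (a, b) \<Rightarrow> ?T a b)) (range (g i))" for i
      using S by (cases i) simp
    show "range (g i) \<inter> range (g j) = {}" if "i \<in> ?I" "j \<in> ?I" "i \<noteq> j" for i j
    proof -
      \<comment> \<open>In the listed order the offsets have residues 0, 4, 2, 1, 3.\<close>
      have "(fst i - 2 * snd i) mod 5 \<noteq> (fst j - 2 * snd j) mod 5"
        using that by auto
      then show ?thesis
        using range_g[of "fst i" "snd i"] range_g[of "fst j" "snd j"] by auto
    qed
  qed simp
  also have "(\<Union>i\<in>?I. range (g i)) = UNIV"
  proof -
    have *: "c mod 5 = 0 \<or> c mod 5 = 1 \<or> c mod 5 = 2 \<or> c mod 5 = 3 \<or> c mod 5 = 4" for c :: int
      by presburger
    have "(m, n) \<in> (\<Union>i\<in>?I. range (g i))" for m n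
      using *[of "m - 2 * n"] by (simp add: range_g) blast
    then show ?thesis by (metis UNIV_eq_I surj_pair)
  qed
  finally show ?thesis
    using theta_mult_has_sum[OF P(1), of x y] has_sum_unique unfolding F_def by blast
qed

subsection \<open>Infinite q-Pochhammer symbols\<close>

lemma qpoch_inf_mult_minus:
  assumes "norm q < 1"
  shows "qpoch_inf a q * qpoch_inf (- a) q = qpoch_inf (a\<^sup>2) (q\<^sup>2)"
proof (rule LIMSEQ_unique)
  have q2: "norm (q\<^sup>2) < 1"
    using assms by (auto simp: norm_power power_less_one_iff)
  show "(\<lambda>n. \<Prod>i<n. 1 - a\<^sup>2 * (q\<^sup>2) ^ i) \<longlonglongrightarrow> qpoch_inf (a\<^sup>2) (q\<^sup>2)"
    by (rule qpoch_inf_LIMSEQ[OF q2])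
  have "(1 - a * q ^ i) * (1 - (- a) * q ^ i) = 1 - a\<^sup>2 * (q\<^sup>2) ^ i" for i
    by (simp add: algebra_simps power2_eq_square power_mult_distrib)
  then show "(\<lambda>n. \<Prod>i<n. 1 - a\<^sup>2 * (q\<^sup>2) ^ i) \<longlonglongrightarrow> qpoch_inf a q * qpoch_inf (- a) q"
    using tendsto_mult[OF qpoch_inf_LIMSEQ[OF assms, of a] qpoch_inf_LIMSEQ[OF assms, of "- a"]]
    by (simp flip: prod.distrib)
qed

lemma qpoch_inf_split_even_odd:
  assumes "norm q < 1"
  shows "qpoch_inf a q = qpoch_inf a (q\<^sup>2) * qpoch_inf (a * q) (q\<^sup>2)"
proof (rule LIMSEQ_unique)
  have q2: "norm (q\<^sup>2) < 1"
    using assms by (auto simp: norm_power power_less_one_iff)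
  show "(\<lambda>n. \<Prod>i<2*n. 1 - a * q ^ i) \<longlonglongrightarrow> qpoch_inf a q"
    using filterlim_compose[OF qpoch_inf_LIMSEQ[OF assms] filterlim_subseq[of "\<lambda>n. 2 * n"]]
    by (simp add: strict_mono_def)
  have "(\<Prod>i<2*n. 1 - a * q ^ i) = (\<Prod>i<n. 1 - a * (q\<^sup>2) ^ i) * (\<Prod>i<n. 1 - a * q * (q\<^sup>2) ^ i)" for n
    by (induction n) (simp_all add: mult_ac flip: power_mult)
  then show "(\<lambda>n. \<Prod>i<2*n. 1 - a * q ^ i) \<longlonglongrightarrow> qpoch_inf a (q\<^sup>2) * qpoch_inf (a * q) (q\<^sup>2)"
    using tendsto_mult[OF qpoch_inf_LIMSEQ[OF q2, of a] qpoch_inf_LIMSEQ[OF q2, of "a * q"]]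
    by simp
qed

text \<open>On a closed disc of radius \<open>r < 1\<close> the partial products converge uniformly,
  with majorant \<open>norm c * (r ^ b) ^ n\<close>. The form \<open>c * q ^ a\<close> covers
  positive powers of \<open>q\<close>, their negatives and the constant \<open>-1\<close>.\<close>

lemma continuous_on_qpoch_inf:
  assumes "0 < b"
  shows "continuous_on (ball 0 1) (\<lambda>q. qpoch_inf (c * q ^ a) (q ^ b))"
proof -
  have cball: "continuous_on (cball 0 r) (\<lambda>q. qpoch_inf (c * q ^ a) (q ^ b))" if r: "0 \<le> r" "r < 1" for r
  proof -
    define f where "f = (\<lambda>i (q::complex). 1 - c * q ^ a * (q ^ b) ^ i)"
    have cont: "continuous_on (cball 0 r) (f i)" for i
      unfolding f_def by (intro continuous_intros)
    have rb: "r ^ b < 1" using r assms by (simp add: power_less_one_iff)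
    have "uniformly_convergent_on (cball 0 r) (\<lambda>N q. \<Prod>i<N. f i q)"
    proof (rule uniformly_convergent_on_prod'[OF cont])
      show "uniformly_convergent_on (cball 0 r) (\<lambda>N x. \<Sum>n<N. norm (f n x - 1))"
      proof (rule Weierstrass_m_test'_ev[OF always_eventually])
        show "\<forall>n. \<forall>x\<in>cball 0 r. norm (norm (f n x - 1)) \<le> norm c * (r ^ b) ^ n"
        proof (intro allI ballI)
          fix n and x :: complex assume "x \<in> cball 0 r"
          then have x: "norm x \<le> r" by simp
          have "norm x ^ a \<le> 1" "(norm x ^ b) ^ n \<le> (r ^ b) ^ n"
            using x r by (auto intro!: power_mono power_le_one)
          then have "norm c * norm x ^ a * (norm x ^ b) ^ n \<le> norm c * 1 * (r ^ b) ^ n"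
            by (intro mult_mono) (use r in auto)
          then show "norm (norm (f n x - 1)) \<le> norm c * (r ^ b) ^ n"
            by (simp add: f_def norm_mult norm_power)
        qed
        show "summable (\<lambda>n. norm c * (r ^ b) ^ n)"
          using r rb by (intro summable_mult summable_geometric) auto
      qed
    qed auto
    then have "uniform_limit (cball 0 r) (\<lambda>N q. \<Prod>i<N. f i q) (\<lambda>q. lim (\<lambda>N. \<Prod>i<N. f i q)) sequentially"
      using uniformly_convergent_uniform_limit_iff by blast
    moreover have "lim (\<lambda>N. \<Prod>i<N. f i q) = qpoch_inf (c * q ^ a) (q ^ b)" if "q \<in> cball 0 r" for q
    proof -
      have "norm (q ^ b) < 1"
        using that r assms by (simp add: norm_power power_less_one_iff)
      from qpoch_inf_LIMSEQ[OF this] show ?thesis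
        unfolding f_def by (rule limI)
    qed
    ultimately have "uniform_limit (cball 0 r) (\<lambda>N q. \<Prod>i<N. f i q) (\<lambda>q. qpoch_inf (c * q ^ a) (q ^ b)) sequentially"
      by (metis (no_types, lifting) uniform_limit_cong')
    then show ?thesis
      by (rule uniform_limit_theorem[rotated]) (auto intro!: always_eventually continuous_on_prod cont)
  qed
  show ?thesis
    unfolding continuous_on_eq_continuous_at[OF open_ball]
  proof
    fix x :: complex assume "x \<in> ball 0 1"
    then obtain r where *: "norm x < r" "r < 1"
      using dense[of "norm x" 1] by auto
    then have "0 \<le> r" by (meson less_imp_le norm_ge_zero order_trans)
    from cball[OF this *(2)] show "isCont (\<lambda>q. qpoch_inf (c * q ^ a) (q ^ b)) x"
      by (rule continuous_on_interior) (use * in auto)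
  qed
qed

subsection \<open>The product side\<close>

text \<open>With \<open>x = y = q\<close> in \<open>theta_mult_mod5\<close>, the first four offsets
  have prefactor 1 and all give the same product, up to \<open>theta_inverse\<close>. The offset
  (0,1) has prefactor \<open>q\<^sup>2\<close> and both arguments \<open>q ^ 5\<close>.\<close>

lemma theta_self_square:
  assumes "norm q < 1" "q \<noteq> 0"
  shows "(theta q q)\<^sup>2 = q\<^sup>2 * (theta (q ^ 5) (q ^ 5))\<^sup>2 + 4 * theta (q ^ 5) (q ^ 3) * theta (q ^ 5) q"
proof -
  define T where "T = (\<lambda>a b. q powi a * q powi b * q powi (a\<^sup>2 + b\<^sup>2) *
      (theta (q ^ 5) (q\<^sup>2 * q * q powi (4 * a + 2 * b)) * theta (q ^ 5) (q\<^sup>2 / q * q powi (4 * b - 2 * a))))"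
  have T: "T a b = q powi (a + b + (a\<^sup>2 + b\<^sup>2)) *
      (theta (q ^ 5) (q powi (3 + (4 * a + 2 * b))) * theta (q ^ 5) (q powi (1 + (4 * b - 2 * a))))" for a b
  proof -
    have "q\<^sup>2 * q = q powi 3" "q\<^sup>2 / q = q powi 1"
      using assms by (simp_all add: eval_nat_numeral)
    then show ?thesis
      using assms(2) unfolding T_def by (simp only: power_int_add simp_thms)
  qed
  have "theta q q * theta q q = (\<Sum>(a, b)\<in>{(0, 0), (-1, 0), (0, -1), (-1, -1), (0, 1)}. T a b)"
    unfolding T_def by (rule theta_mult_mod5[OF assms assms(2) assms(2)])
  also have "\<dots> = T 0 0 + T (-1) 0 + T 0 (-1) + T (-1) (-1) + T 0 1"
    by (simp add: add_ac)
  also have "\<dots> = q\<^sup>2 * (theta (q ^ 5) (q ^ 5) * theta (q ^ 5) (q ^ 5))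
     + 4 * theta (q ^ 5) (q ^ 3) * theta (q ^ 5) q"
    unfolding T by (simp add: power_int_minus theta_inverse)
  finally have "theta q q * theta q q = \<dots>" .
  then show ?thesis by (simp only: power2_eq_square)
qed

text \<open>In the parity expansions of the two squares, the terms containing
  \<open>theta (q ^ 5) 1\<close> cancel; what remains is \<open>q * theta (q ^ 5) (q ^ 5)\<close>
  times the expansion of the mixed product. Writing \<open>- inverse p\<close> instead of
  \<open>- p\<close>, and likewise for the cube, keeps all arguments between 1 and
  \<open>q ^ 5\<close> after \<open>theta_inverse\<close>.\<close>

lemma theta_difference:
  assumes p: "norm p < 1" "p \<noteq> 0" and q: "q = p\<^sup>2"
  shows "theta (q ^ 5) (q ^ 3) * (theta (p ^ 5) (- inverse p))\<^sup>2
      - theta (q ^ 5) q * (theta (p ^ 5) (- inverse (p ^ 3)))\<^sup>2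
    = q * theta (q ^ 5) (q ^ 5) * theta (p ^ 5) (- inverse (p ^ 3)) * theta (p ^ 5) (- inverse p)"
proof -
  have P: "norm (p ^ 5) < 1" "p ^ 5 \<noteq> 0"
    using p by (auto simp: norm_power power_less_one_iff)
  have P2: "(p ^ 5)\<^sup>2 = q ^ 5" by (simp add: q flip: power_mult)
  have nz: "- inverse p \<noteq> 0" "- inverse (p ^ 3) \<noteq> 0" using p by auto
  have 1: "theta (p ^ 5) (- inverse p) * theta (p ^ 5) (- inverse p) =
    theta (q ^ 5) q * theta (q ^ 5) 1 - q\<^sup>2 * theta (q ^ 5) (q ^ 4) * theta (q ^ 5) (q ^ 5)"
  proof -
    have e: "- inverse p * - inverse p = inverse q" "- inverse p / - inverse p = 1"
      "- inverse p * p ^ 5 = - q\<^sup>2" "inverse q * q ^ 5 = q ^ 4" "- inverse p * q ^ 5 / - inverse p = q ^ 5"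
      using p by (simp_all add: q field_simps eval_nat_numeral)
    show ?thesis
      unfolding theta_mult_parity[OF P nz(1) nz(1)] P2 e theta_inverse by simp
  qed
  have 2: "theta (p ^ 5) (- inverse (p ^ 3)) * theta (p ^ 5) (- inverse (p ^ 3)) =
    theta (q ^ 5) (q ^ 3) * theta (q ^ 5) 1 - q * theta (q ^ 5) (q\<^sup>2) * theta (q ^ 5) (q ^ 5)"
  proof -
    have e: "- inverse (p ^ 3) * - inverse (p ^ 3) = inverse (q ^ 3)" "- inverse (p ^ 3) / - inverse (p ^ 3) = 1"
      "- inverse (p ^ 3) * p ^ 5 = - q" "inverse (q ^ 3) * q ^ 5 = q\<^sup>2"
      "- inverse (p ^ 3) * q ^ 5 / - inverse (p ^ 3) = q ^ 5"
      using p by (simp_all add: q field_simps eval_nat_numeral)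
    show ?thesis
      unfolding theta_mult_parity[OF P nz(2) nz(2)] P2 e theta_inverse by simp
  qed
  have 3: "theta (p ^ 5) (- inverse (p ^ 3)) * theta (p ^ 5) (- inverse p) =
    theta (q ^ 5) (q\<^sup>2) * theta (q ^ 5) q - q * theta (q ^ 5) (q ^ 3) * theta (q ^ 5) (q ^ 4)"
  proof -
    have e: "- inverse (p ^ 3) * - inverse p = inverse (q\<^sup>2)" "- inverse (p ^ 3) / - inverse p = inverse q"
      "- inverse (p ^ 3) * p ^ 5 = - q" "inverse (q\<^sup>2) * q ^ 5 = q ^ 3"
      "- inverse (p ^ 3) * q ^ 5 / - inverse p = q ^ 4"
      using p by (simp_all add: q field_simps eval_nat_numeral)
    show ?thesis
      unfolding theta_mult_parity[OF P nz(2) nz(1)] P2 e theta_inverse by simp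
  qed
  show ?thesis
    unfolding power2_eq_square[of "theta _ _"] 1 2 mult.assoc[of _ "theta (p ^ 5) _"] 3
    by (simp add: algebra_simps power2_eq_square)
qed

section \<open>The series and the product as theta values\<close>

text \<open>The exponent \<open>m(m + 1)\<close> is invariant under \<open>m\<close> to
  \<open>-1 - m\<close>, which swaps the non-negative and the negative integers, so each half
  carries half of the theta value.\<close>

lemma sums_theta_self:
  assumes q: "norm q < 1" "q \<noteq> 0"
  shows "(\<lambda>n. q ^ (n * (n + 1))) sums (theta q q / 2)"
proof -
  define S where "S = infsum (theta_term q q) (range int)"
  have term_eq: "theta_term q q m = q powi (m * (m + 1))" for m
    using q by (simp add: theta_term_def power2_eq_square algebra_simps flip: power_int_add)
  have "(theta_term q q has_sum S) (range int)"
    unfolding S_def using theta_has_sum[OF q(1), of q]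
    by (intro has_sum_infsum summable_on_subset_banach[OF has_sum_imp_summable]) auto
  moreover from this have "(theta_term q q has_sum S) (range (\<lambda>n. - 1 - int n))"
    by (subst (asm) has_sum_reindex, simp, subst has_sum_reindex)
       (auto simp: inj_on_def o_def term_eq algebra_simps)
  moreover have "range int \<inter> range (\<lambda>n. - 1 - int n) = {}"
    by auto
  ultimately have "(theta_term q q has_sum (S + S)) (range int \<union> range (\<lambda>n. - 1 - int n))"
    by (rule has_sum_Un_disjoint)
  also have "range int \<union> range (\<lambda>n. - 1 - int n) = UNIV"
  proof -
    have "m \<in> range int \<union> range (\<lambda>n. - 1 - int n)" for m
      by (cases m rule: int_cases) auto
    then show ?thesis by blast
  qed
  finally have "S + S = theta q q"
    using theta_has_sum[OF q(1)] has_sum_unique by blast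
  then have S: "S = theta q q / 2" by (simp add: field_simps)
  have "theta_term q q (int n) = q ^ (n * (n + 1))" for n
    unfolding term_eq by (metis of_nat_1 of_nat_add of_nat_mult power_int_of_nat)
  with \<open>(theta_term q q has_sum S) (range int)\<close> have "((\<lambda>n. q ^ (n * (n + 1))) has_sum S) UNIV"
    by (subst (asm) has_sum_reindex) (auto simp: o_def)
  then show ?thesis
    unfolding S by (rule has_sum_imp_sums)
qed

lemma qpoch_inf_0 [simp]: "qpoch_inf 0 q = 1"
  by (simp add: qpoch_inf_def)

lemma qpoch_inf_0_right: "qpoch_inf a 0 = 1 - a"
proof -
  have "(\<lambda>i. if i = 0 then 1 - a else 1) has_prod (1 - a)"
    using has_prod_single[of 0 "\<lambda>_. 1 - a"] by simp
  moreover have "1 - a * 0 ^ i = (if i = 0 then 1 - a else 1)" for i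
    by simp
  ultimately show ?thesis
    unfolding qpoch_inf_def by (simp only: has_prod_unique[symmetric])
qed

definition product_side :: "complex \<Rightarrow> complex" where
  "product_side q = qpochs_inf [q ^ 3, q ^ 7, q ^ 10] (q ^ 10) * qpochs_inf [q ^ 4, q ^ 16] (q ^ 20)
      / qpochs_inf [q, q ^ 4] (q ^ 5)"

text \<open>All three theta values are triple products. Splitting those in
  \<open>theta (p ^ 5) (- inverse p)\<close> from base \<open>q ^ 5\<close> to \<open>q ^ 10\<close>
  gives parameters \<open>q\<^sup>2\<close>, \<open>q ^ 7\<close>, \<open>q ^ 3\<close>,
  \<open>q ^ 8\<close>; here \<open>q\<^sup>2\<close> and \<open>q ^ 8\<close> pair with their
  negatives from \<open>theta (q ^ 5) (q ^ 3)\<close> into the symbols of base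
  \<open>q ^ 20\<close>.\<close>

lemma product_side_theta:
  assumes p: "norm p < 1" "p \<noteq> 0" and q: "q = p\<^sup>2"
  shows "product_side q * theta (p ^ 5) (- inverse (p ^ 3)) = theta (q ^ 5) (q ^ 3) * theta (p ^ 5) (- inverse p)"
    and "theta (p ^ 5) (- inverse (p ^ 3)) \<noteq> 0"
    and "theta (p ^ 5) (- inverse p) \<noteq> 0"
proof -
  have P: "norm (p ^ 5) < 1" "p ^ 5 \<noteq> 0"
    using p by (auto simp: norm_power power_less_one_iff)
  have q1: "norm q < 1" "q \<noteq> 0"
    using p by (auto simp: q norm_power power_less_one_iff)
  then have qn: "norm (q ^ n) < 1" if "n > 0" for n
    using that by (auto simp: norm_power power_less_one_iff)
  have e: "(p ^ 5)\<^sup>2 = q ^ 5" "(q ^ 5)\<^sup>2 = q ^ 10" "- (- inverse p) * p ^ 5 = q\<^sup>2" "- (p ^ 5) / - inverse p = q ^ 3"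
     "- (- inverse (p ^ 3)) * p ^ 5 = q" "- (p ^ 5) / - inverse (p ^ 3) = q ^ 4"
     "- (q ^ 3) * q ^ 5 = - (q ^ 8)" "- (q ^ 5) / q ^ 3 = - (q\<^sup>2)"
    using p by (simp_all add: q field_simps eval_nat_numeral)
  have j1: "theta (p ^ 5) (- inverse (p ^ 3)) = qpoch_inf (q ^ 5) (q ^ 5) * qpoch_inf q (q ^ 5) * qpoch_inf (q ^ 4) (q ^ 5)"
    using jacobi_triple_product[OF P, of "- inverse (p ^ 3)"] p unfolding e by simp
  have j2: "theta (p ^ 5) (- inverse p) = qpoch_inf (q ^ 5) (q ^ 5) * qpoch_inf (q\<^sup>2) (q ^ 5) * qpoch_inf (q ^ 3) (q ^ 5)"
    using jacobi_triple_product[OF P, of "- inverse p"] p unfolding e by simp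
  have F2: "theta (q ^ 5) (q ^ 3) = qpoch_inf (q ^ 10) (q ^ 10) * qpoch_inf (- (q ^ 8)) (q ^ 10) * qpoch_inf (- (q\<^sup>2)) (q ^ 10)"
    using jacobi_triple_product[of "q ^ 5" "q ^ 3"] q1 qn[of 5] unfolding e by simp
  show "theta (p ^ 5) (- inverse (p ^ 3)) \<noteq> 0" "theta (p ^ 5) (- inverse p) \<noteq> 0"
    unfolding j1 j2 using qn[of 5] qn[of 2] qn[of 3] qn[of 4] q1
    by (simp_all add: qpoch_inf_nonzero)
  have f: "(q ^ 10)\<^sup>2 = q ^ 20" "q\<^sup>2 * q ^ 5 = q ^ 7" "q ^ 3 * q ^ 5 = q ^ 8" "(q\<^sup>2)\<^sup>2 = q ^ 4" "(q ^ 8)\<^sup>2 = q ^ 16"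
    by (simp_all flip: power_mult power_add)
  have s2: "qpoch_inf (q\<^sup>2) (q ^ 5) = qpoch_inf (q\<^sup>2) (q ^ 10) * qpoch_inf (q ^ 7) (q ^ 10)"
    using qpoch_inf_split_even_odd[of "q ^ 5" "q\<^sup>2"] qn[of 5] unfolding e f by simp
  have s3: "qpoch_inf (q ^ 3) (q ^ 5) = qpoch_inf (q ^ 3) (q ^ 10) * qpoch_inf (q ^ 8) (q ^ 10)"
    using qpoch_inf_split_even_odd[of "q ^ 5" "q ^ 3"] qn[of 5] unfolding e f by simp
  have m4: "qpoch_inf (q ^ 4) (q ^ 20) = qpoch_inf (q\<^sup>2) (q ^ 10) * qpoch_inf (- (q\<^sup>2)) (q ^ 10)"
    using qpoch_inf_mult_minus[of "q ^ 10" "q\<^sup>2"] qn[of 10] unfolding f by simp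
  have m16: "qpoch_inf (q ^ 16) (q ^ 20) = qpoch_inf (q ^ 8) (q ^ 10) * qpoch_inf (- (q ^ 8)) (q ^ 10)"
    using qpoch_inf_mult_minus[of "q ^ 10" "q ^ 8"] qn[of 10] unfolding f by simp
  have "qpoch_inf q (q ^ 5) \<noteq> 0" "qpoch_inf (q ^ 4) (q ^ 5) \<noteq> 0"
    using qn[of 5] qn[of 4] q1 by (simp_all add: qpoch_inf_nonzero)
  then show "product_side q * theta (p ^ 5) (- inverse (p ^ 3)) = theta (q ^ 5) (q ^ 3) * theta (p ^ 5) (- inverse p)"
    unfolding j1 j2 F2 s2 s3 product_side_def qpochs_inf_def by (simp add: m4 m16)
qed

text \<open>In the notation \<open>X\<close>, \<open>Y\<close> this is
  \<open>(X + Y)^2 = (X - Y)^2 + 4 X Y\<close>, with denominators cleared by the nonzero factor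
  \<open>u * v\<close>.\<close>

lemma product_side_square:
  assumes q: "norm q < 1" "q \<noteq> 0"
  shows "(2 * product_side q - q * theta (q ^ 5) (q ^ 5))\<^sup>2 = (theta q q)\<^sup>2"
proof -
  define p where "p = csqrt q"
  have qp: "q = p\<^sup>2" and p0: "p \<noteq> 0" using q by (auto simp: p_def)
  have p1: "norm p < 1" using q by (simp add: qp norm_power power_less_one_iff)
  define A B H u v where "A = theta (q ^ 5) (q ^ 3)" and "B = theta (q ^ 5) q" and "H = theta (q ^ 5) (q ^ 5)"
    and "u = theta (p ^ 5) (- inverse (p ^ 3))" and "v = theta (p ^ 5) (- inverse p)"
  note defs = A_def B_def H_def u_def v_def
  have R: "product_side q * u = A * v" and uv: "u \<noteq> 0" "v \<noteq> 0"
    using product_side_theta[OF p1 p0 qp] by (simp_all add: defs)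
  have D: "A * v\<^sup>2 - B * u\<^sup>2 = q * H * u * v"
    using theta_difference[OF p1 p0 qp] by (simp add: defs)
  have "(2 * product_side q - q * H) * (u * v) = 2 * (product_side q * u) * v - q * H * u * v"
    by (simp add: algebra_simps)
  also have "\<dots> = A * v\<^sup>2 + B * u\<^sup>2"
    unfolding R D[symmetric] by (simp add: algebra_simps power2_eq_square)
  finally have "((2 * product_side q - q * H) * (u * v))\<^sup>2 = (A * v\<^sup>2 - B * u\<^sup>2)\<^sup>2 + 4 * A * B * (u * v)\<^sup>2"
    by (simp add: algebra_simps power2_eq_square)
  also have "\<dots> = (q\<^sup>2 * H\<^sup>2 + 4 * A * B) * (u * v)\<^sup>2"
    unfolding D by (simp add: algebra_simps power2_eq_square)
  also have "q\<^sup>2 * H\<^sup>2 + 4 * A * B = (theta q q)\<^sup>2"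
    unfolding theta_self_square[OF q] by (simp add: defs)
  finally show ?thesis
    using uv unfolding power_mult_distrib H_def by simp
qed

lemma theta_self_product:
  assumes "norm q < 1" "q \<noteq> 0"
  shows "theta q q = qpoch_inf (q\<^sup>2) (q\<^sup>2) * qpoch_inf (- (q\<^sup>2)) (q\<^sup>2) * qpoch_inf (- 1) (q\<^sup>2)"
  using jacobi_triple_product[OF assms assms(2)] assms by (simp add: power2_eq_square)

section \<open>The choice of the sign\<close>

lemma continuous_on_product_side: "continuous_on (ball 0 1) product_side"
proof -
  have c: "continuous_on (ball 0 1) (\<lambda>q. qpoch_inf (q ^ a) (q ^ b))" if "b > 0" for a b
    using continuous_on_qpoch_inf[OF that, of 1 a] by simp
  have c1: "continuous_on (ball 0 1) (\<lambda>q. qpoch_inf q (q ^ 5))"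
    using c[of 5 1] by simp
  have "qpoch_inf q (q ^ 5) * qpoch_inf (q ^ 4) (q ^ 5) \<noteq> 0" if "norm q < 1" for q
    using that by (simp add: qpoch_inf_nonzero norm_power power_less_one_iff)
  then show ?thesis
    unfolding product_side_def[abs_def] qpochs_inf_def
    by (auto intro!: continuous_intros c c1)
qed

lemma product_side_eq:
  assumes "norm q < 1" "q \<noteq> 0"
  shows "product_side q = (theta q q + q * theta (q ^ 5) (q ^ 5)) / 2"
proof -
  \<comment> \<open>The product gives the continuous extension of \<open>theta q q\<close> to 0,
    with value 2. In contrast \<open>theta 0 0\<close> is 1: at \<open>q = 0\<close> the term of
    index -1 is 0, although it equals 1 for every other \<open>q\<close>.\<close>
  define G where "G = (\<lambda>q. qpoch_inf (q\<^sup>2) (q\<^sup>2) * qpoch_inf (- (q\<^sup>2)) (q\<^sup>2) * qpoch_inf (- 1) (q\<^sup>2))"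
  define D where "D = (\<lambda>q. 2 * product_side q - q * G (q ^ 5))"
  have G: "theta x x = G x" if "norm x < 1" "x \<noteq> 0" for x
    unfolding G_def by (rule theta_self_product[OF that])
  have pow: "norm (x ^ 5) < 1" "norm (x ^ 2) < 1" if "norm x < 1" for x :: complex
    using that by (simp_all add: norm_power power_less_one_iff)
  have G0: "G x \<noteq> 0" if x: "norm x < 1" for x
  proof -
    \<comment> \<open>A zero requires \<open>(x\<^sup>2) ^ i = -1\<close>; comparing norms forces
      \<open>i = 0\<close>, where the power is 1.\<close>
    have "qpoch_inf (- 1) (x\<^sup>2) \<noteq> 0"
    proof
      assume "qpoch_inf (- 1) (x\<^sup>2) = 0"
      then obtain i where i: "(x\<^sup>2) ^ i = - 1"
        using pow(2)[OF x] by (auto simp: qpoch_inf_eq_0_iff minus_equation_iff)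
      then have "norm (x\<^sup>2) ^ i = 1" by (metis norm_minus_cancel norm_one norm_power)
      then have "i = 0"
        using pow(2)[OF x] by (metis less_irrefl norm_ge_zero power_less_one_iff not_gr_zero)
      then show False using i by simp
    qed
    then show ?thesis
      using pow(2)[OF x] by (simp add: G_def qpoch_inf_nonzero)
  qed
  have sq: "(D x)\<^sup>2 = (G x)\<^sup>2" if x: "norm x < 1" for x
  proof (cases "x = 0")
    case True
    then show ?thesis
      by (simp add: D_def G_def product_side_def qpochs_inf_def qpoch_inf_0_right)
  next
    case False
    then show ?thesis
      using product_side_square[OF x False] G[OF x False] G[of "x ^ 5"] pow(1)[OF x] by (simp add: D_def)
  qed
  have contG: "continuous_on (ball 0 1) G"
    unfolding G_def
    using continuous_on_qpoch_inf[of 2 1 2] continuous_on_qpoch_inf[of 2 "-1" 2]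
      continuous_on_qpoch_inf[of 2 "-1" 0]
    by (intro continuous_on_mult) simp_all
  have "continuous_on (ball 0 1) (\<lambda>x. G (x ^ 5))"
    by (rule continuous_on_compose2[OF contG]) (auto intro!: continuous_intros pow)
  then have contD: "continuous_on (ball 0 1) D"
    unfolding D_def by (intro continuous_intros continuous_on_product_side)
  have "(\<lambda>x. D x / G x) constant_on ball 0 1"
  \<comment> \<open>The quotient takes only the values 1 and -1, and the disc is connected.\<close>
  proof (rule continuous_finite_range_constant)
    show "continuous_on (ball 0 1) (\<lambda>x. D x / G x)"
      by (intro continuous_intros contD contG) (use G0 in auto)
    have "D x / G x \<in> {1, - 1}" if "x \<in> ball 0 1" for x
      using sq[of x] G0[of x] that by (auto simp: power2_eq_iff)
    then show "finite ((\<lambda>x. D x / G x) ` ball 0 1)"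
      by (meson finite.emptyI finite.insertI finite_subset image_subsetI)
  qed auto
  then obtain c where c: "D x / G x = c" if "norm x < 1" for x
    unfolding constant_on_def by auto
  \<comment> \<open>At 0 the product side is 1, so numerator and denominator are both 2.\<close>
  have "D 0 / G 0 = 1"
    by (simp add: D_def G_def product_side_def qpochs_inf_def qpoch_inf_0_right)
  then have "D q / G q = 1"
    using c[of 0] c[OF assms(1)] by simp
  then have "D q = G q"
    using G0[OF assms(1)] by simp
  then show ?thesis
    using G[OF assms] G[of "q ^ 5"] pow(1)[OF assms(1)] assms by (simp add: D_def field_simps)
qed

theorem theorem17:
  fixes q :: complex
  assumes "norm q < 1"
  shows "(\<lambda>n. q ^ (n * (n + 1)) + q ^ (5 * n * (n + 1) + 1)) sums
    (qpochs_inf [q ^ 3, q ^ 7, q ^ 10] (q ^ 10) * qpochs_inf [q ^ 4, q ^ 16] (q ^ 20)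
      / qpochs_inf [q, q ^ 4] (q ^ 5))"
proof (cases "q = 0")
  case True
  \<comment> \<open>Only \<open>0 ^ 0 = 1\<close> at \<open>n = 0\<close> survives, and every symbol
    on the product side is 1.\<close>
  then have "q ^ (n * (n + 1)) + q ^ (5 * n * (n + 1) + 1) = (if n = 0 then 1 else 0)" for n
    by auto
  then show ?thesis
    using sums_single[of 0 "\<lambda>_. 1 :: complex"] True by (simp add: qpochs_inf_def)
next
  case False
  have q5: "norm (q ^ 5) < 1" "q ^ 5 \<noteq> 0"
    using assms False by (auto simp: norm_power power_less_one_iff)
  \<comment> \<open>The second half of the series is \<open>q\<close> times the first with
    \<open>q ^ 5\<close> in place of \<open>q\<close>.\<close>
  have "(\<lambda>n. q ^ (n * (n + 1)) + q * (q ^ 5) ^ (n * (n + 1))) sums (theta q q / 2 + q * (theta (q ^ 5) (q ^ 5) / 2))"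
    by (intro sums_add sums_mult sums_theta_self assms False q5)
  also have "theta q q / 2 + q * (theta (q ^ 5) (q ^ 5) / 2) = product_side q"
    unfolding product_side_eq[OF assms False] by (simp add: add_divide_distrib)
  also have "(\<lambda>n. q ^ (n * (n + 1)) + q * (q ^ 5) ^ (n * (n + 1))) = (\<lambda>n. q ^ (n * (n + 1)) + q ^ (5 * n * (n + 1) + 1))"
    by (simp only: power_mult[symmetric] power_Suc Suc_eq_plus1[symmetric] mult.assoc)
  finally show ?thesis
    unfolding product_side_def .
qed

end
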